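(* The density $$\phi_0(t)=\frac{1}{t(\pi^2+\log^2 t)}$$ is completely monotone on $(0,\infty)$. Consequently the function $$I_R(x)=\int_0^\infty\frac{e^{-xt}}{t\,(\pi^2+\log^2 t)}\,dt,\qquad x>0,$$ is a Stieltjes function, and its primitive $$P_R(x)=c+\int_0^\infty\frac{1-e^{-xt}}{t^2(\pi^2+\log^2 t)}\,dt,\qquad x>0,\quad c\ge 0,$$ is a complete Bernstein function.
   Context: A function $f:(0,\infty)\to[0,\infty)$ is completely monotone if $f\in C^\infty$ and $(-1)^n f^{(n)}(x)\ge 0$ for all $n\ge 0$, $x>0$. A function $f:(0,\infty)\to[0,\infty)$ is a Stieltjes function if $f(x)=\frac{a}{x}+b+\int_{(0,\infty)}\frac{\sigma(dt)}{x+t}$ with $a,b\ge 0$ and $\sigma$ a positive measure on $(0,\infty)$ with $\int_{(0,\infty)}\frac{\sigma(dt)}{1+t}<\infty$. A function $g:(0,\infty)\to[0,\infty)$ is a Bernstein function if $g\in C^\infty$ and $g'$ is completely monotone; equivalently, with unique $(a,b,\nu)$, $g(x)=a+bx+\int_{(0,\infty)}(1-e^{-xt})\,\nu(dt)$, where $a,b\ge 0$ and $\nu$ is a positive measure on $(0,\infty)$ (the Lévy measure) with $\int(1\wedge t)\,\nu(dt)<\infty$. A Bernstein function is a complete Bernstein function if its Lévy measure is absolutely continuous with a completely monotone density. $\log^2 t$ means $(\log t)^2$. *)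

theory Defs
  imports "HOL-Analysis.Analysis"
begin

text \<open>
  Functions on \<open>(0,\<infinity>)\<close> are represented by total functions \<open>real \<Rightarrow> real\<close> whose values
  outside \<open>(0,\<infinity>)\<close> are irrelevant: since \<open>{0<..}\<close> is open, the (iterated) derivatives
  at positive points depend only on the values at positive points.
\<close>

definition smooth_on_pos :: "(real \<Rightarrow> real) \<Rightarrow> bool" where
  "smooth_on_pos f \<longleftrightarrow> (\<forall>n. \<forall>x>0. (deriv ^^ n) f differentiable (at x))"

definition completely_monotone :: "(real \<Rightarrow> real) \<Rightarrow> bool" where
  "completely_monotone f \<longleftrightarrow>
     (\<forall>x>0. 0 \<le> f x) \<and> smooth_on_pos f \<and>
     (\<forall>n. \<forall>x>0. 0 \<le> (-1) ^ n * (deriv ^^ n) f x)"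

definition measure_on_pos :: "real measure \<Rightarrow> bool" where
  "measure_on_pos M \<longleftrightarrow> sets M = sets (restrict_space borel {0<..})"

definition stieltjes_function :: "(real \<Rightarrow> real) \<Rightarrow> bool" where
  "stieltjes_function f \<longleftrightarrow>
     (\<forall>x>0. 0 \<le> f x) \<and>
     (\<exists>a b \<sigma>. 0 \<le> a \<and> 0 \<le> b \<and> measure_on_pos \<sigma> \<and>
        integrable \<sigma> (\<lambda>t. 1 / (1 + t)) \<and>
        (\<forall>x>0. f x = a / x + b + (\<integral>t. 1 / (x + t) \<partial>\<sigma>)))"

definition bernstein_function :: "(real \<Rightarrow> real) \<Rightarrow> bool" where
  "bernstein_function g \<longleftrightarrow>
     (\<forall>x>0. 0 \<le> g x) \<and> smooth_on_pos g \<and> completely_monotone (deriv g)"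

definition levy_triplet :: "(real \<Rightarrow> real) \<Rightarrow> real \<Rightarrow> real \<Rightarrow> real measure \<Rightarrow> bool" where
  "levy_triplet g a b \<nu> \<longleftrightarrow>
     0 \<le> a \<and> 0 \<le> b \<and> measure_on_pos \<nu> \<and>
     integrable \<nu> (\<lambda>t. min 1 t) \<and>
     (\<forall>x>0. g x = a + b * x + (\<integral>t. (1 - exp (- (x * t))) \<partial>\<nu>))"

text \<open>
  The triplet of a Bernstein function is unique, so the existential quantifier over \<open>\<nu>\<close>
  speaks about the Levy measure of \<open>g\<close>.
\<close>

definition complete_bernstein_function :: "(real \<Rightarrow> real) \<Rightarrow> bool" where
  "complete_bernstein_function g \<longleftrightarrow>
     bernstein_function g \<and>
     (\<exists>a b \<nu> m. levy_triplet g a b \<nu> \<and> completely_monotone m \<and>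
        \<nu> = density (restrict_space lborel {0<..}) (\<lambda>t. ennreal (m t)))"

definition phi0 :: "real \<Rightarrow> real" where
  "phi0 t = 1 / (t * (pi\<^sup>2 + (ln t)\<^sup>2))"

definition I_R :: "real \<Rightarrow> real" where
  "I_R x = (LINT t:{0<..}|lborel. exp (- (x * t)) / (t * (pi\<^sup>2 + (ln t)\<^sup>2)))"

definition P_R :: "real \<Rightarrow> real \<Rightarrow> real" where
  "P_R c x = c + (LINT t:{0<..}|lborel. (1 - exp (- (x * t))) / (t\<^sup>2 * (pi\<^sup>2 + (ln t)\<^sup>2)))"

end

theory Submission
  imports Defs "HOL-Real_Asymp.Real_Asymp"
begin

text \<open>
  The function \<open>phi0\<close> continues analytically to the plane cut along the negative half-line, but its
  jump across the cut changes sign at \<open>-1\<close>, where it has a pole. Pairing the points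
  \<open>- exp w\<close> and \<open>- exp (- w)\<close> of the cut, at which the jumps are opposite in the logarithmic
  coordinate \<open>w\<close>, repairs this: the Cauchy integral of \<open>phi0\<close> along the cut becomes
  \<open>phi0 t = \<integral> weight w * (1 / (t + exp (- w)) - 1 / (t + exp w)) dw\<close> over \<open>w > 0\<close>, with the positive
  weight \<open>2 / (w * (w\<^sup>2 + 4 pi\<^sup>2))\<close> (lemma \<open>has_bochner_integral_phi0_cut\<close>). Since \<open>1 / (t + r)\<close> is the
  Laplace transform of \<open>exp (- r * s)\<close> and \<open>exp (- w) < exp w\<close>, this exhibits \<open>phi0\<close> as the
  Laplace transform of the nonnegative density
  \<open>\<rho> s = \<integral> weight w * (exp (- exp (- w) * s) - exp (- exp w * s)) dw\<close>
  (lemma \<open>laplace_transform_phi0\<close>).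

  The remaining claims follow from this density. A Laplace transform of a nonnegative density is
  completely monotone. \<open>I_R\<close> is the Laplace transform of \<open>phi0\<close>, hence the iterated Laplace transform
  of \<open>\<rho>\<close>, which is the Stieltjes transform \<open>\<integral> \<rho> s / (x + s) ds\<close>. The Levy density of \<open>P_R\<close> is
  \<open>phi0 t / t\<close>, which is again a Laplace transform, namely of the primitive of \<open>\<rho>\<close>.

  The integral formula for \<open>phi0\<close> is proved by real methods. With \<open>t = exp x\<close> it reads
  \<open>1 / (pi\<^sup>2 + x\<^sup>2) = \<integral> weight w * sinh w / (cosh w + cosh x) dw\<close>
  (lemma \<open>has_bochner_integral_weight_sinh\<close>). The kernel is a mean of two hyperbolic tangents, whose
  partial fractions come from the reflection formula of the digamma function. Each partial fraction
  gives a rational integrand with an elementary value (lemma \<open>integral_conj_poisson\<close>), and the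
  sum of these values telescopes.
\<close>

section \<open>Lebesgue measure on the positive half-line\<close>

abbreviation lborel_pos :: "real measure" where
  "lborel_pos \<equiv> restrict_space lborel {0<..}"

lemma space_lborel_pos [simp]: "space lborel_pos = {0<..}"
  by (simp add: space_restrict_space)

lemma measurable_lborel_pos_id [measurable]: "(\<lambda>x. x) \<in> measurable lborel_pos borel"
  by (rule measurable_restrict_space1) simp

lemma sets_lborel_pos: "sets lborel_pos = sets (restrict_space borel {0<..})"
  by (simp add: sets_restrict_space)

lemma set_integrable_iff_lborel_pos:
  fixes f :: "real \<Rightarrow> real"
  shows "set_integrable lborel {0<..} f \<longleftrightarrow> integrable lborel_pos f"
  by (simp add: set_integrable_def integrable_restrict_space)

lemma set_integral_eq_lborel_pos:
  fixes f :: "real \<Rightarrow> real"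
  shows "(LINT t:{0<..}|lborel. f t) = integral\<^sup>L lborel_pos f"
  by (simp add: set_lebesgue_integral_def integral_restrict_space)

interpretation lborel_pos: sigma_finite_measure lborel_pos
  by (intro sigma_finite_measure_restrict_space sigma_finite_lborel) auto

interpretation lborel_pos_pair: pair_sigma_finite lborel_pos lborel_pos ..

lemma integral_lborel_pos_FTC:
  fixes f F :: "real \<Rightarrow> real"
  assumes F: "\<And>x. 0 < x \<Longrightarrow> (F has_real_derivative f x) (at x)"
    and f: "\<And>x. 0 < x \<Longrightarrow> isCont f x"
    and int: "integrable lborel_pos f"
    and A: "(F \<longlongrightarrow> A) (at_right 0)"
    and B: "(F \<longlongrightarrow> B) at_top"
  shows "integral\<^sup>L lborel_pos f = B - A"
proof -
  have "(LBINT x=0..\<infinity>. f x) = B - A"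
  proof (rule interval_integral_FTC_integrable)
    show "((F \<circ> real_of_ereal) \<longlongrightarrow> A) (at_right 0)"
      using A by (simp add: ereal_tendsto_simps1 zero_ereal_def)
    show "((F \<circ> real_of_ereal) \<longlongrightarrow> B) (at_left \<infinity>)"
      using B by (simp add: ereal_tendsto_simps1)
    show "set_integrable lborel (einterval 0 \<infinity>) f"
      using int by (simp add: set_integrable_iff_lborel_pos zero_ereal_def)
  qed (use F f in \<open>auto simp: zero_ereal_def has_real_derivative_iff_has_vector_derivative\<close>)
  thus ?thesis
    by (simp add: interval_lebesgue_integral_def zero_ereal_def set_integral_eq_lborel_pos)
qed

lemma has_bochner_integral_lborel_pos_FTC:
  fixes f F :: "real \<Rightarrow> real"
  assumes F: "\<And>x. 0 < x \<Longrightarrow> (F has_real_derivative f x) (at x)"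
    and f: "\<And>x. 0 < x \<Longrightarrow> isCont f x"
    and nonneg: "\<And>x. 0 < x \<Longrightarrow> 0 \<le> f x"
    and A: "(F \<longlongrightarrow> A) (at_right 0)"
    and B: "(F \<longlongrightarrow> B) at_top"
  shows "has_bochner_integral lborel_pos f (B - A)"
proof -
  have "set_integrable lborel (einterval 0 \<infinity>) f"
  proof (rule interval_integral_FTC_nonneg)
    show "((F \<circ> real_of_ereal) \<longlongrightarrow> A) (at_right 0)"
      using A by (simp add: ereal_tendsto_simps1 zero_ereal_def)
    show "((F \<circ> real_of_ereal) \<longlongrightarrow> B) (at_left \<infinity>)"
      using B by (simp add: ereal_tendsto_simps1)
  qed (use F f nonneg in \<open>auto simp: zero_ereal_def\<close>)
  hence "integrable lborel_pos f"
    by (simp add: set_integrable_iff_lborel_pos zero_ereal_def)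
  thus ?thesis
    using integral_lborel_pos_FTC[OF F f _ A B] by (simp add: has_bochner_integral_iff)
qed

lemma has_bochner_integral_exp_pos:
  fixes c :: real
  assumes "0 < c"
  shows "has_bochner_integral lborel_pos (\<lambda>s. exp (- (c * s))) (1 / c)"
proof -
  have "has_bochner_integral lborel_pos (\<lambda>s. exp (- (c * s))) (0 - (- 1 / c))"
  proof (rule has_bochner_integral_lborel_pos_FTC)
    show "((\<lambda>s. - exp (- (c * s)) / c) has_real_derivative exp (- (c * x))) (at x)" for x
      using assms by (auto intro!: derivative_eq_intros)
    show "((\<lambda>s. - exp (- (c * s)) / c) \<longlongrightarrow> - 1 / c) (at_right 0)"
      by (auto intro!: tendsto_eq_intros simp: assms less_imp_neq[symmetric])
    have "LIM s at_top. c * s :> at_top"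
      using assms by (intro filterlim_tendsto_pos_mult_at_top[OF tendsto_const]) (auto simp: filterlim_ident)
    hence "((\<lambda>s. exp (- (c * s))) \<longlongrightarrow> 0) at_top"
      by (intro filterlim_compose[OF exp_at_bot]) (simp add: filterlim_uminus_at_bot)
    from tendsto_divide[OF tendsto_minus[OF this] tendsto_const[of c]]
    show "((\<lambda>s. - exp (- (c * s)) / c) \<longlongrightarrow> 0) at_top" using assms by simp
  qed auto
  thus ?thesis by simp
qed

lemma nn_integral_exp_pos:
  fixes c :: real
  assumes "0 < c"
  shows "(\<integral>\<^sup>+s. ennreal (exp (- (c * s))) \<partial>lborel_pos) = ennreal (1 / c)"
  using has_bochner_integral_exp_pos[OF assms]
  by (subst nn_integral_eq_integral) (auto simp: has_bochner_integral_iff)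

section \<open>Differentiation under the integral sign\<close>

text \<open>
  The mean value theorem bounds the difference quotients by the integrable majorant of the
  derivatives, so dominated convergence applies.
\<close>

lemma has_real_derivative_integral:
  fixes f f' :: "real \<Rightarrow> 'a \<Rightarrow> real"
  assumes "0 < e"
    and deriv: "\<And>y t. \<bar>y - x\<bar> < e \<Longrightarrow> t \<in> space M \<Longrightarrow> ((\<lambda>y. f y t) has_real_derivative f' y t) (at y)"
    and bound: "\<And>y t. \<bar>y - x\<bar> < e \<Longrightarrow> t \<in> space M \<Longrightarrow> \<bar>f' y t\<bar> \<le> g t"
    and g: "integrable M g"
    and int: "\<And>y. \<bar>y - x\<bar> < e \<Longrightarrow> integrable M (f y)"
    and meas: "f' x \<in> borel_measurable M"
  shows "((\<lambda>y. \<integral>t. f y t \<partial>M) has_real_derivative (\<integral>t. f' x t \<partial>M)) (at x)"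
  unfolding DERIV_def tendsto_at_iff_sequentially
proof (intro allI impI)
  fix h :: "nat \<Rightarrow> real"
  assume h: "\<forall>i. h i \<in> UNIV - {0}" "h \<longlonglongrightarrow> 0"
  have "eventually (\<lambda>i. \<bar>h i\<bar> < e) sequentially"
    using tendstoD[OF h(2) \<open>0 < e\<close>] by (simp add: dist_real_def)
  then obtain N where N: "\<And>i. i \<ge> N \<Longrightarrow> \<bar>h i\<bar> < e"
    by (auto simp: eventually_sequentially)
  define q where "q i t = (f (x + h (i + N)) t - f x t) / h (i + N)" for i t
  have int_h: "\<And>i. integrable M (f (x + h (i + N)))" "integrable M (f x)"
    using N \<open>0 < e\<close> by (auto intro!: int)
  have "(\<lambda>i. \<integral>t. q i t \<partial>M) \<longlonglongrightarrow> (\<integral>t. f' x t \<partial>M)"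
  proof (rule integral_dominated_convergence)
    show "q i \<in> borel_measurable M" for i
      unfolding q_def using int_h by simp
    show "AE t in M. norm (q i t) \<le> g t" for i
    proof (rule AE_I2)
      fix t assume t: "t \<in> space M"
      have *: "\<bar>y - x\<bar> < e" if "y \<in> closed_segment x (x + h (i + N))" for y
        using that N[of "i + N"] by (auto simp: closed_segment_eq_real_ivl split: if_splits)
      have "norm (f (x + h (i + N)) t - f x t) \<le> g t * norm ((x + h (i + N)) - x)"
        using * deriv bound t
        by (intro field_differentiable_bound[of "closed_segment x (x + h (i + N))" _ "\<lambda>y. f' y t"])
          (auto intro: has_field_derivative_at_within)
      thus "norm (q i t) \<le> g t"
        using h(1) by (simp add: q_def field_simps abs_mult)
    qed
    show "AE t in M. (\<lambda>i. q i t) \<longlonglongrightarrow> f' x t"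
    proof (rule AE_I2)
      fix t assume t: "t \<in> space M"
      have "((\<lambda>h. (f (x + h) t - f x t) / h) \<longlongrightarrow> f' x t) (at 0)"
        using deriv[of x t] t \<open>0 < e\<close> by (simp add: DERIV_def)
      hence "((\<lambda>h. (f (x + h) t - f x t) / h) \<circ> h) \<longlonglongrightarrow> f' x t"
        unfolding tendsto_at_iff_sequentially using h by blast
      from LIMSEQ_ignore_initial_segment[where k = N, OF this]
      show "(\<lambda>i. q i t) \<longlonglongrightarrow> f' x t" by (simp add: q_def o_def)
    qed
  qed (use g meas in auto)
  also have "(\<lambda>i. \<integral>t. q i t \<partial>M) =
     (\<lambda>i. ((\<lambda>h. ((\<integral>t. f (x + h) t \<partial>M) - (\<integral>t. f x t \<partial>M)) / h) \<circ> h) (i + N))"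
    using int_h by (simp add: q_def o_def)
  finally show "((\<lambda>h. ((\<integral>t. f (x + h) t \<partial>M) - (\<integral>t. f x t \<partial>M)) / h) \<circ> h)
      \<longlonglongrightarrow> (\<integral>t. f' x t \<partial>M)"
    by (rule LIMSEQ_offset)
qed

section \<open>Completely monotone functions and Laplace transforms\<close>

lemma deriv_funpow_cong_pos:
  fixes f g :: "real \<Rightarrow> real"
  assumes "\<And>x. 0 < x \<Longrightarrow> f x = g x" "0 < x"
  shows "(deriv ^^ n) f x = (deriv ^^ n) g x"
  using assms(2)
proof (induction n arbitrary: x)
  case (Suc n)
  have "eventually (\<lambda>y. y \<in> {0<..}) (nhds x)"
    using Suc.prems by (intro eventually_nhds_in_open) auto
  hence "eventually (\<lambda>y. (deriv ^^ n) f y = (deriv ^^ n) g y) (nhds x)"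
    by eventually_elim (simp add: Suc.IH)
  thus ?case by (simp add: deriv_cong_ev)
qed (use assms in auto)

lemma differentiable_cong_pos:
  fixes f g :: "real \<Rightarrow> real"
  assumes "\<And>x. 0 < x \<Longrightarrow> f x = g x" "0 < x" "g differentiable (at x)"
  shows "f differentiable (at x)"
proof (rule differentiable_transform_within[OF assms(3), of x])
  show "g y = f y" if "dist y x < x" for y
    using that assms(1,2) by (auto simp: dist_real_def)
qed (use assms in auto)

lemma smooth_on_pos_cong:
  assumes eq: "\<And>x. 0 < x \<Longrightarrow> f x = g x" and g: "smooth_on_pos g"
  shows "smooth_on_pos f"
  unfolding smooth_on_pos_def
proof (intro allI impI)
  fix n x assume x: "0 < (x::real)"
  show "(deriv ^^ n) f differentiable at x"
    by (rule differentiable_cong_pos[OF deriv_funpow_cong_pos[OF eq] x])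
      (use g x in \<open>auto simp: smooth_on_pos_def\<close>)
qed

lemma completely_monotone_cong:
  assumes eq: "\<And>x. 0 < x \<Longrightarrow> f x = g x" and g: "completely_monotone g"
  shows "completely_monotone f"
  using g smooth_on_pos_cong[OF eq] deriv_funpow_cong_pos[OF eq] eq
  unfolding completely_monotone_def by auto

text \<open>
  Half of the exponent absorbs the power, because \<open>z ^ n / n!\<close> is one term of the series of
  \<open>exp z\<close>. This makes every derivative of a Laplace integral converge as soon as the
  integral itself does.
\<close>

lemma power_mult_exp_le:
  fixes y s :: real
  assumes "0 < y" "0 \<le> s"
  shows "s ^ n * exp (- (y * s)) \<le> fact n * (2 / y) ^ n * exp (- (y / 2 * s))"
proof -
  define z where "z = y / 2 * s"
  have z: "0 \<le> z" using assms by (simp add: z_def)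
  have "(\<Sum>k\<in>{n}. inverse (fact k) *\<^sub>R z ^ k) \<le> (\<Sum>k. inverse (fact k) *\<^sub>R z ^ k)"
    by (rule sum_le_suminf[OF summable_exp_generic]) (use z in auto)
  hence "z ^ n / fact n \<le> exp z"
    by (simp add: exp_def field_simps)
  hence *: "z ^ n \<le> fact n * exp z" by (simp add: field_simps)
  have "s ^ n * exp (- (y * s)) = (2 / y) ^ n * z ^ n * exp (- z) * exp (- z)"
    using assms by (simp add: z_def power_mult_distrib[symmetric] exp_add[symmetric])
  also have "\<dots> \<le> (2 / y) ^ n * (fact n * exp z) * exp (- z) * exp (- z)"
    using * assms by (intro mult_right_mono mult_left_mono) auto
  also have "\<dots> = fact n * (2 / y) ^ n * exp (- (y / 2 * s))"
    by (simp add: z_def exp_minus field_simps)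
  finally show ?thesis .
qed

text \<open>
  The easy half of Bernstein's theorem: each differentiation under the integral sign brings down
  a factor \<open>- h\<close>.
\<close>

lemma completely_monotone_integral_exp:
  fixes f :: "real \<Rightarrow> real" and h :: "'a \<Rightarrow> real"
  assumes [measurable]: "h \<in> borel_measurable M"
    and h: "\<And>s. s \<in> space M \<Longrightarrow> 0 \<le> h s"
    and int: "\<And>x. 0 < x \<Longrightarrow> integrable M (\<lambda>s. exp (- (x * h s)))"
    and f: "\<And>x. 0 < x \<Longrightarrow> f x = (\<integral>s. exp (- (x * h s)) \<partial>M)"
  shows "completely_monotone f"
proof -
  have int_n: "integrable M (\<lambda>s. h s ^ n * exp (- (x * h s)))" if "0 < x" for x n
  proof (rule Bochner_Integration.integrable_bound)
    show "integrable M (\<lambda>s. fact n * (2 / x) ^ n * exp (- (x / 2 * h s)))"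
      using int[of "x / 2"] that by simp
    show "AE s in M. norm (h s ^ n * exp (- (x * h s))) \<le> norm (fact n * (2 / x) ^ n * exp (- (x / 2 * h s)))"
      using power_mult_exp_le[OF that h, of _ n] h that by (intro AE_I2) (simp add: abs_mult)
  qed simp
  define D where "D n x = (\<integral>s. (- h s) ^ n * exp (- (x * h s)) \<partial>M)" for n x
  have D: "(D n has_real_derivative D (Suc n) x) (at x)" if x: "0 < x" for n x
    unfolding D_def
  proof (rule has_real_derivative_integral)
    show "0 < x / 2" using x by simp
    show "((\<lambda>y. (- h s) ^ n * exp (- (y * h s))) has_real_derivative
        (- h s) ^ Suc n * exp (- (y * h s))) (at y)" for y s
      by (auto intro!: derivative_eq_intros)
    show "integrable M (\<lambda>s. h s ^ Suc n * exp (- (x / 2 * h s)))"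
      using x by (intro int_n) auto
    show "\<bar>(- h s) ^ Suc n * exp (- (y * h s))\<bar> \<le> h s ^ Suc n * exp (- (x / 2 * h s))"
      if "\<bar>y - x\<bar> < x / 2" "s \<in> space M" for y s
    proof -
      have "x / 2 * h s \<le> y * h s"
        using that x h by (intro mult_right_mono) (auto simp: abs_if split: if_splits)
      thus ?thesis using h[OF that(2)]
        by (simp add: abs_mult power_abs mult_left_mono)
    qed
    show "integrable M (\<lambda>s. (- h s) ^ n * exp (- (y * h s)))" if "\<bar>y - x\<bar> < x / 2" for y
    proof -
      have "0 < y" using that x by (auto simp: abs_if split: if_splits)
      from integrable_mult_right[OF int_n[OF this, of n], of "(-1) ^ n"]
      show ?thesis by (simp add: power_minus[of "h _"] mult.assoc)
    qed
  qed simp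
  have deriv_f: "(deriv ^^ n) f x = D n x" if "0 < x" for n x
    using that
  proof (induction n arbitrary: x)
    case (Suc n)
    have "eventually (\<lambda>y. y \<in> {0<..}) (nhds x)"
      using Suc.prems by (intro eventually_nhds_in_open) auto
    hence "eventually (\<lambda>y. (deriv ^^ n) f y = D n y) (nhds x)"
      by eventually_elim (simp add: Suc.IH)
    hence "deriv ((deriv ^^ n) f) x = deriv (D n) x" by (simp add: deriv_cong_ev)
    also have "\<dots> = D (Suc n) x" using D[OF Suc.prems] by (rule DERIV_imp_deriv)
    finally show ?case by simp
  qed (simp add: f D_def)
  have sign: "0 \<le> (-1) ^ n * D n x" for n x
  proof -
    have "(-1) ^ n * D n x = (\<integral>s. h s ^ n * exp (- (x * h s)) \<partial>M)"
      by (simp add: D_def power_minus[of "h _"] mult.assoc)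
    also have "\<dots> \<ge> 0" by (intro Bochner_Integration.integral_nonneg) (use h in auto)
    finally show ?thesis .
  qed
  have "(deriv ^^ n) f differentiable (at x)" if "0 < x" for n x
    by (rule differentiable_cong_pos[OF deriv_f that])
      (use D[OF that] in \<open>auto simp: real_differentiable_def\<close>)
  moreover have "0 \<le> f x" if "0 < x" for x
    using sign[of 0 x] deriv_f[OF that, of 0] by simp
  ultimately show ?thesis
    unfolding completely_monotone_def smooth_on_pos_def using sign deriv_f by auto
qed

text \<open>
  The density is extended-valued, so that it can be an arbitrary integral of nonnegative
  functions and Tonelli's theorem applies without a discussion of finiteness. Convergence
  of the transform is expressed by the finiteness of \<open>f\<close>.
\<close>

definition laplace_transform_of :: "(real \<Rightarrow> ennreal) \<Rightarrow> (real \<Rightarrow> real) \<Rightarrow> bool" where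
  "laplace_transform_of \<rho> f \<longleftrightarrow> \<rho> \<in> borel_measurable lborel_pos \<and>
     (\<forall>x>0. 0 \<le> f x \<and> (\<integral>\<^sup>+s. \<rho> s * ennreal (exp (- (x * s))) \<partial>lborel_pos) = ennreal (f x))"

lemma laplace_transform_imp_completely_monotone:
  assumes "laplace_transform_of \<rho> f"
  shows "completely_monotone f"
proof (rule completely_monotone_integral_exp)
  have [measurable]: "\<rho> \<in> borel_measurable lborel_pos"
    using assms by (simp add: laplace_transform_of_def)
  have eq: "(\<integral>\<^sup>+s. ennreal (exp (- (x * s))) \<partial>density lborel_pos \<rho>) = ennreal (f x)" if "0 < x" for x
    using assms that by (simp add: nn_integral_density laplace_transform_of_def)
  show "integrable (density lborel_pos \<rho>) (\<lambda>s. exp (- (x * s)))" if "0 < x" for x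
    using eq[OF that] by (intro integrableI_nonneg) auto
  show "f x = (\<integral>s. exp (- (x * s)) \<partial>density lborel_pos \<rho>)" if "0 < x" for x
    using assms that eq[OF that] by (simp add: integral_eq_nn_integral laplace_transform_of_def)
qed auto

text \<open>
  Since \<open>1 / x\<close> is the transform of the constant density 1, division by \<open>x\<close> is convolution
  with that density, that is, passing from \<open>\<rho>\<close> to its primitive.
\<close>

lemma laplace_transform_divide_id:
  assumes "laplace_transform_of \<rho> f"
  shows "laplace_transform_of (\<lambda>r. \<integral>\<^sup>+s. \<rho> s * indicator {s<..} r \<partial>lborel_pos) (\<lambda>x. f x / x)"
  unfolding laplace_transform_of_def
proof (intro conjI allI impI)
  have [measurable]: "\<rho> \<in> borel_measurable lborel_pos"
    using assms by (simp add: laplace_transform_of_def)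
  have ind: "indicator {s<..} r = (if s < r then 1 else 0 :: ennreal)" for s r :: real
    by simp
  show "(\<lambda>r. \<integral>\<^sup>+s. \<rho> s * indicator {s<..} r \<partial>lborel_pos) \<in> borel_measurable lborel_pos"
    unfolding ind by measurable
  fix x :: real assume x: "0 < x"
  have f: "(\<integral>\<^sup>+s. \<rho> s * ennreal (exp (- (x * s))) \<partial>lborel_pos) = ennreal (f x)" "0 \<le> f x"
    using assms x by (auto simp: laplace_transform_of_def)
  show "0 \<le> f x / x" using f x by simp
  have tail: "(\<integral>\<^sup>+r. indicator {s<..} r * ennreal (exp (- (x * r))) \<partial>lborel_pos)
      = ennreal (exp (- (x * s))) * ennreal (1 / x)" if "0 < s" for s
  proof -
    have "(\<integral>\<^sup>+r. indicator {s<..} r * ennreal (exp (- (x * r))) \<partial>lborel_pos)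
        = (\<integral>\<^sup>+r. ennreal (exp (- (x * r))) * indicator {s<..} r \<partial>lborel)"
      using that by (auto simp: nn_integral_restrict_space intro!: nn_integral_cong split: split_indicator)
    also have "\<dots> = (\<integral>\<^sup>+r. ennreal (exp (- (x * (s + 1 * r)))) * indicator {s<..} (s + 1 * r) \<partial>lborel)"
      by (subst nn_integral_real_affine[where c = 1 and t = s]) auto
    also have "\<dots> = (\<integral>\<^sup>+r. ennreal (exp (- (x * s))) * (ennreal (exp (- (x * r))) * indicator {0<..} r) \<partial>lborel)"
      by (intro nn_integral_cong)
        (auto simp: ring_distribs exp_add exp_diff exp_minus field_simps ennreal_mult[symmetric] split: split_indicator)
    also have "\<dots> = ennreal (exp (- (x * s))) * (\<integral>\<^sup>+r. ennreal (exp (- (x * r))) \<partial>lborel_pos)"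
      by (simp add: nn_integral_cmult nn_integral_restrict_space)
    finally show ?thesis using x by (simp add: nn_integral_exp_pos)
  qed
  have "(\<integral>\<^sup>+r. (\<integral>\<^sup>+s. \<rho> s * indicator {s<..} r \<partial>lborel_pos) * ennreal (exp (- (x * r))) \<partial>lborel_pos)
     = (\<integral>\<^sup>+r. (\<integral>\<^sup>+s. \<rho> s * (indicator {s<..} r * ennreal (exp (- (x * r)))) \<partial>lborel_pos) \<partial>lborel_pos)"
    unfolding ind by (subst nn_integral_multc[symmetric]) (auto simp: mult.assoc)
  also have "\<dots> = (\<integral>\<^sup>+s. (\<integral>\<^sup>+r. \<rho> s * (indicator {s<..} r * ennreal (exp (- (x * r)))) \<partial>lborel_pos) \<partial>lborel_pos)"
    unfolding ind by (rule lborel_pos_pair.Fubini') measurable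
  also have "\<dots> = (\<integral>\<^sup>+s. \<rho> s * (\<integral>\<^sup>+r. indicator {s<..} r * ennreal (exp (- (x * r))) \<partial>lborel_pos) \<partial>lborel_pos)"
    unfolding ind by (intro nn_integral_cong nn_integral_cmult) measurable
  also have "\<dots> = (\<integral>\<^sup>+s. (\<rho> s * ennreal (exp (- (x * s)))) * ennreal (1 / x) \<partial>lborel_pos)"
    by (intro nn_integral_cong) (simp add: tail mult.assoc)
  also have "\<dots> = ennreal (f x / x)"
    using x f by (simp add: nn_integral_multc ennreal_mult[symmetric])
  finally show "(\<integral>\<^sup>+r. (\<integral>\<^sup>+s. \<rho> s * indicator {s<..} r \<partial>lborel_pos) * ennreal (exp (- (x * r))) \<partial>lborel_pos)
     = ennreal (f x / x)" .
qed

text \<open>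
  An iterated Laplace transform is a Stieltjes transform, because the inner integral of
  \<open>exp (- (x + s) * t)\<close> over \<open>t\<close> is \<open>1 / (x + s)\<close>.
\<close>

lemma laplace_transform_twice_imp_stieltjes:
  assumes "laplace_transform_of \<rho> f" "laplace_transform_of (\<lambda>t. ennreal (f t)) F"
  shows "stieltjes_function F"
proof -
  have [measurable]: "\<rho> \<in> borel_measurable lborel_pos"
    using assms by (simp add: laplace_transform_of_def)
  define \<sigma> where "\<sigma> = density lborel_pos \<rho>"
  have F: "(\<integral>\<^sup>+s. ennreal (1 / (x + s)) \<partial>\<sigma>) = ennreal (F x)" "0 \<le> F x" if x: "0 < x" for x
  proof -
    have "ennreal (F x) = (\<integral>\<^sup>+t. ennreal (f t) * ennreal (exp (- (x * t))) \<partial>lborel_pos)"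
      using assms(2) x by (simp add: laplace_transform_of_def)
    also have "\<dots> = (\<integral>\<^sup>+t. (\<integral>\<^sup>+s. \<rho> s * ennreal (exp (- (t * s))) \<partial>lborel_pos) * ennreal (exp (- (x * t))) \<partial>lborel_pos)"
      using assms(1) by (intro nn_integral_cong) (simp add: laplace_transform_of_def)
    also have "\<dots> = (\<integral>\<^sup>+t. (\<integral>\<^sup>+s. \<rho> s * ennreal (exp (- ((x + s) * t))) \<partial>lborel_pos) \<partial>lborel_pos)"
      by (subst nn_integral_multc[symmetric])
        (auto intro!: nn_integral_cong simp: mult.assoc ennreal_mult[symmetric] exp_add[symmetric] algebra_simps)
    also have "\<dots> = (\<integral>\<^sup>+s. (\<integral>\<^sup>+t. \<rho> s * ennreal (exp (- ((x + s) * t))) \<partial>lborel_pos) \<partial>lborel_pos)"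
      by (rule lborel_pos_pair.Fubini') measurable
    also have "\<dots> = (\<integral>\<^sup>+s. \<rho> s * ennreal (1 / (x + s)) \<partial>lborel_pos)"
      using x by (intro nn_integral_cong) (simp add: nn_integral_cmult nn_integral_exp_pos)
    finally show "(\<integral>\<^sup>+s. ennreal (1 / (x + s)) \<partial>\<sigma>) = ennreal (F x)"
      by (simp add: \<sigma>_def nn_integral_density)
    show "0 \<le> F x" using assms(2) x by (simp add: laplace_transform_of_def)
  qed
  have nonneg: "AE s in \<sigma>. 0 \<le> 1 / (x + s)" if "0 < x" for x
    using that by (intro AE_I2) (simp add: \<sigma>_def)
  have "integrable \<sigma> (\<lambda>t. 1 / (1 + t))"
    using F[of 1] nonneg[of 1] by (intro integrableI_nonneg) (auto simp: \<sigma>_def)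
  moreover have "F x = 0 / x + 0 + (\<integral>t. 1 / (x + t) \<partial>\<sigma>)" if x: "0 < x" for x
    using F[OF x] nonneg[OF x] by (subst integral_eq_nn_integral) (auto simp: \<sigma>_def)
  moreover have "measure_on_pos \<sigma>"
    by (simp add: measure_on_pos_def \<sigma>_def sets_lborel_pos)
  ultimately show ?thesis
    unfolding stieltjes_function_def using F by (metis order_refl)
qed

section \<open>The partial fraction expansion of the hyperbolic tangent\<close>

text \<open>
  The logarithmic derivative of Euler's reflection formula, taken in the form for the entire
  function \<open>rGamma\<close> so that no poles of \<open>Gamma\<close> interfere.
\<close>

lemma Digamma_reflection_complex:
  fixes z :: complex
  assumes "z \<notin> \<int>"
  shows "Digamma (1 - z) - Digamma z = of_real pi * cot (of_real pi * z)"
proof -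
  have z: "z \<notin> \<int>\<^sub>\<le>\<^sub>0" "1 - z \<notin> \<int>\<^sub>\<le>\<^sub>0"
    using assms nonpos_Ints_Int[of z] nonpos_Ints_Int[of "1 - z"] Ints_diff[of 1 "1 - z"] by auto
  have "((\<lambda>z. rGamma z * rGamma (1 - z)) has_field_derivative
      rGamma z * rGamma (1 - z) * (Digamma (1 - z) - Digamma z)) (at z)"
    using z by (auto intro!: derivative_eq_intros simp: algebra_simps)
  moreover have "((\<lambda>z. rGamma z * rGamma (1 - z)) has_field_derivative cos (of_real pi * z)) (at z)"
    unfolding rGamma_reflection_complex by (auto intro!: derivative_eq_intros)
  ultimately have "rGamma z * rGamma (1 - z) * (Digamma (1 - z) - Digamma z) = cos (of_real pi * z)"
    by (rule DERIV_unique)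
  moreover have "sin (of_real pi * z) \<noteq> 0"
  proof
    assume "sin (of_real pi * z) = 0"
    then obtain n :: int where "of_real pi * z = of_real (n * pi)"
      by (auto simp: sin_eq_0)
    hence "of_real pi * z = of_real pi * of_int n" by simp
    hence "z = of_int n" by (simp only: mult_cancel_left) simp
    thus False using assms by simp
  qed
  ultimately show ?thesis
    unfolding rGamma_reflection_complex by (simp add: cot_def field_simps)
qed

text \<open>
  On the line \<open>Re z = 1/2\<close> the cotangent in the reflection formula for the digamma function is
  a hyperbolic tangent, and the difference of the two digamma series is the expansion sought.
\<close>

lemma sums_tanh_half:
  fixes y :: real
  shows "(\<lambda>k. 4 * y / (y\<^sup>2 + ((2 * real k + 1) * pi)\<^sup>2)) sums tanh (y / 2)"
proof -
  \<comment> \<open>Scaled so that \<open>pi * z = pi / 2 + \<i> * (y / 2)\<close>.\<close>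
  define v where "v = y / (2 * pi)"
  define z where "z = Complex (1/2) v"
  have z: "z \<notin> \<int>"
  proof
    assume "z \<in> \<int>"
    then obtain n where "z = of_int n" by (auto elim: Ints_cases)
    hence "1 / 2 = real_of_int n" by (simp add: z_def complex_eq_iff)
    hence "real_of_int (2 * n) = real_of_int 1" by simp
    hence "2 * n = 1" by (simp only: of_int_eq_iff)
    thus False by presburger
  qed
  have "z \<noteq> 0" "1 - z \<noteq> 0" using z by auto
  have *: "(\<lambda>k. inverse (of_nat (Suc k)) - inverse (w + of_nat k)) sums (Digamma w + euler_mascheroni)"
    if "w \<noteq> 0" for w :: complex
    using summable_sums[OF summable_Digamma[OF that]] by (simp add: Digamma_def)
  have "(\<lambda>k. inverse (1 - z + of_nat k) - inverse (z + of_nat k)) sums (Digamma z - Digamma (1 - z))"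
    using sums_diff[OF *[OF \<open>z \<noteq> 0\<close>] *[OF \<open>1 - z \<noteq> 0\<close>]] by simp
  also have "Digamma z - Digamma (1 - z) = \<i> * of_real (pi * tanh (pi * v))"
  proof -
    have "of_real pi * z = of_real pi / 2 + \<i> * of_real (pi * v)"
      by (simp add: z_def complex_eq_iff)
    moreover have "sin (\<i> * of_real (pi * v)) = \<i> * of_real (sinh (pi * v))"
      "cos (\<i> * of_real (pi * v)) = of_real (cosh (pi * v))"
      using sinh_conv_sin[of "complex_of_real (pi * v)"] cosh_conv_cos[of "complex_of_real (pi * v)"]
      by (simp_all add: sinh_def cosh_def exp_of_real scaleR_conv_of_real exp_minus
          del: of_real_mult)
    ultimately have "cos (of_real pi * z) = - \<i> * of_real (sinh (pi * v))"
      "sin (of_real pi * z) = of_real (cosh (pi * v))"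
      by (simp_all add: cos_add sin_add cos_of_real_pi_half del: of_real_mult)
    hence "cot (of_real pi * z) = - \<i> * of_real (tanh (pi * v))"
      by (simp add: cot_def tanh_def)
    thus ?thesis using Digamma_reflection_complex[OF z] by (simp add: algebra_simps)
  qed
  finally have "(\<lambda>k. Im (inverse (1 - z + of_nat k) - inverse (z + of_nat k))) sums (pi * tanh (pi * v))"
    using sums_Im by fastforce
  also have "(\<lambda>k. Im (inverse (1 - z + of_nat k) - inverse (z + of_nat k))) =
      (\<lambda>k. 2 * v / ((1 / 2 + real k)\<^sup>2 + v\<^sup>2))"
    by (simp add: z_def fun_eq_iff)
  finally have "(\<lambda>k. 2 * v / ((1 / 2 + real k)\<^sup>2 + v\<^sup>2) / pi) sums (pi * tanh (pi * v) / pi)"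
    by (rule sums_divide)
  also have "(\<lambda>k. 2 * v / ((1 / 2 + real k)\<^sup>2 + v\<^sup>2) / pi) = (\<lambda>k. 4 * y / (y\<^sup>2 + ((2 * real k + 1) * pi)\<^sup>2))"
  proof
    fix k :: nat
    have "(1 / 2 + real k)\<^sup>2 + v\<^sup>2 = (y\<^sup>2 + ((2 * real k + 1) * pi)\<^sup>2) / (4 * pi\<^sup>2)"
      by (simp add: v_def field_simps power2_eq_square)
    thus "2 * v / ((1 / 2 + real k)\<^sup>2 + v\<^sup>2) / pi = 4 * y / (y\<^sup>2 + ((2 * real k + 1) * pi)\<^sup>2)"
      by (simp add: v_def power2_eq_square)
  qed
  finally show ?thesis by (simp add: v_def)
qed

lemma sinh_div_cosh_add_cosh:
  fixes w x :: real
  shows "sinh w / (cosh w + cosh x) = (tanh ((w + x) / 2) + tanh ((w - x) / 2)) / 2"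
proof -
  define u v where "u = (w + x) / 2" and "v = (w - x) / 2"
  have wx: "w = u + v" "x = u - v" by (simp_all add: u_def v_def field_simps)
  have "cosh w + cosh x = 2 * (cosh u * cosh v)"
    unfolding wx by (simp add: cosh_add cosh_diff)
  moreover have "sinh w = sinh u * cosh v + cosh u * sinh v"
    unfolding wx by (simp add: sinh_add)
  ultimately have "sinh w / (cosh w + cosh x) = (tanh u + tanh v) / 2"
    by (simp add: tanh_def field_simps)
  thus ?thesis by (simp add: u_def v_def)
qed

section \<open>A family of rational integrals\<close>

lemma has_real_derivative_arctan_affine:
  fixes d y w :: real
  assumes "0 < d"
  shows "((\<lambda>w. arctan ((w + y) / d)) has_real_derivative d / ((w + y)\<^sup>2 + d\<^sup>2)) (at w)"
proof -
  have "((w + y) / d)\<^sup>2 + 1 = ((w + y)\<^sup>2 + d\<^sup>2) / d\<^sup>2"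
    using assms by (simp add: field_simps)
  hence "inverse (1 + ((w + y) / d)\<^sup>2) / d = d / ((w + y)\<^sup>2 + d\<^sup>2)"
    using assms by (simp add: add.commute power2_eq_square)
  moreover have "((\<lambda>w. arctan ((w + y) / d)) has_real_derivative inverse (1 + ((w + y) / d)\<^sup>2) / d) (at w)"
    using assms by (auto intro!: derivative_eq_intros simp: divide_inverse)
  ultimately show ?thesis by simp
qed

lemma has_bochner_integral_inverse_square_add:
  fixes b :: real
  assumes "0 < b"
  shows "has_bochner_integral lborel_pos (\<lambda>w. 1 / (w\<^sup>2 + b\<^sup>2)) (pi / (2 * b))"
proof -
  have nz: "w\<^sup>2 + b\<^sup>2 \<noteq> 0" for w using assms by (simp add: sum_power2_eq_zero_iff)
  have "has_bochner_integral lborel_pos (\<lambda>w. 1 / (w\<^sup>2 + b\<^sup>2)) (pi / (2 * b) - 0)"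
  proof (rule has_bochner_integral_lborel_pos_FTC)
    show "((\<lambda>w. arctan (w / b) / b) has_real_derivative 1 / (w\<^sup>2 + b\<^sup>2)) (at w)" for w
      using DERIV_cdivide[OF has_real_derivative_arctan_affine[OF assms, of 0 w], of b] assms by simp
    show "((\<lambda>w. arctan (w / b) / b) \<longlongrightarrow> 0) (at_right 0)"
      using assms by (auto intro!: tendsto_eq_intros)
    have "((\<lambda>w. arctan (w / b)) \<longlongrightarrow> pi / 2) at_top" using assms by real_asymp
    from tendsto_divide[OF this tendsto_const[of b]]
    show "((\<lambda>w. arctan (w / b) / b) \<longlongrightarrow> pi / (2 * b)) at_top" using assms by simp
  qed (use nz in \<open>auto intro!: continuous_intros\<close>)
  thus ?thesis by simp
qed

text \<open>
  The conjugate Poisson kernel of the half-plane at height \<open>a\<close>, symmetrised over the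
  points \<open>x\<close> and \<open>- x\<close>.
\<close>

definition conj_poisson :: "real \<Rightarrow> real \<Rightarrow> real \<Rightarrow> real" where
  "conj_poisson a x w = (w + x) / ((w + x)\<^sup>2 + a\<^sup>2) + (w - x) / ((w - x)\<^sup>2 + a\<^sup>2)"

text \<open>
  The kernel is odd in \<open>w\<close>, hence vanishes at \<open>w = 0\<close>, which compensates the factor
  \<open>1 / w\<close> in the integrals below. The bound is uniform in \<open>x\<close> and summable over \<open>a = (2 k + 1) pi\<close>, so it
  serves as the majorant for exchanging the sum over \<open>k\<close> with the integral over \<open>w\<close>.
\<close>

lemma abs_conj_poisson_le:
  fixes a x w :: real
  assumes "0 < a" "0 < w"
  shows "\<bar>conj_poisson a x w\<bar> \<le> 2 * w / a\<^sup>2"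
proof -
  define P Q where "P = (w + x)\<^sup>2 + a\<^sup>2" and "Q = (w - x)\<^sup>2 + a\<^sup>2"
  have pos: "0 < P" "0 < Q" using assms by (auto simp: P_def Q_def intro!: add_nonneg_pos)
  have "conj_poisson a x w = 2 * w * (w\<^sup>2 - x\<^sup>2 + a\<^sup>2) / (P * Q)"
    using pos by (simp add: conj_poisson_def flip: P_def Q_def)
      (simp add: field_simps, simp add: P_def Q_def algebra_simps power2_eq_square)
  hence "\<bar>conj_poisson a x w\<bar> = 2 * w * \<bar>w\<^sup>2 - x\<^sup>2 + a\<^sup>2\<bar> / (P * Q)"
    using pos assms by (simp add: abs_mult)
  also have "\<dots> \<le> 2 * w / a\<^sup>2"
  proof -
    have "\<bar>w\<^sup>2 - x\<^sup>2 + a\<^sup>2\<bar> \<le> w\<^sup>2 + x\<^sup>2 + a\<^sup>2" by (simp add: abs_le_iff)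
    hence "\<bar>w\<^sup>2 - x\<^sup>2 + a\<^sup>2\<bar> * a\<^sup>2 \<le> (w\<^sup>2 + x\<^sup>2 + a\<^sup>2) * a\<^sup>2" by (rule mult_right_mono) simp
    also have "\<dots> \<le> (w\<^sup>2 + x\<^sup>2 + a\<^sup>2) * a\<^sup>2 + (w\<^sup>2 - x\<^sup>2)\<^sup>2 + a\<^sup>2 * (w\<^sup>2 + x\<^sup>2)" by simp
    also have "\<dots> = P * Q" by (simp add: P_def Q_def algebra_simps power2_eq_square)
    finally have "2 * w * (\<bar>w\<^sup>2 - x\<^sup>2 + a\<^sup>2\<bar> * a\<^sup>2) \<le> 2 * w * (P * Q)"
      using assms by (intro mult_left_mono) auto
    thus ?thesis using pos assms by (simp add: field_simps)
  qed
  finally show ?thesis .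
qed

lemma partial_fractions_zero:
  fixes a x w :: real
  assumes "0 < a" "0 < w"
  shows "(w + x) / (w * ((w + x)\<^sup>2 + a\<^sup>2)) =
    x / (x\<^sup>2 + a\<^sup>2) / w + (a\<^sup>2 - x * (w + x)) / (x\<^sup>2 + a\<^sup>2) / ((w + x)\<^sup>2 + a\<^sup>2)"
proof -
  define P c where "P = (w + x)\<^sup>2 + a\<^sup>2" and "c = x\<^sup>2 + a\<^sup>2"
  have pos: "0 < P" "0 < c" using assms by (auto simp: P_def c_def intro!: add_nonneg_pos)
  have "(w + x) * c = x * P + (a\<^sup>2 - x * (w + x)) * w"
    by (simp add: P_def c_def algebra_simps power2_eq_square)
  hence "(w + x) * c / (c * w * P) = (x * P + (a\<^sup>2 - x * (w + x)) * w) / (c * w * P)"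
    by simp
  also have "\<dots> = x / c / w + (a\<^sup>2 - x * (w + x)) / c / P"
    using pos assms unfolding add_divide_distrib by simp
  also have "(w + x) * c / (c * w * P) = (w + x) / (w * P)"
    using pos by simp
  finally show ?thesis by (simp add: P_def c_def)
qed

text \<open>
  The coefficients are found from the residues at the points \<open>w = - x \<plusminus> \<i> a\<close> and \<open>w = \<plusminus> \<i> b\<close>. The quantities
  \<open>S\<close> and \<open>D\<close> arise as squared distances between these points; the assumption \<open>a \<noteq> b\<close> keeps
  \<open>D\<close> from vanishing at \<open>x = 0\<close>.
\<close>

lemma partial_fractions_square:
  fixes a b x w :: real
  assumes "0 < a" "0 < b" "a \<noteq> b"
  defines "S \<equiv> x\<^sup>2 + (a + b)\<^sup>2" and "D \<equiv> x\<^sup>2 + (a - b)\<^sup>2"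
  shows "w * (w + x) / (((w + x)\<^sup>2 + a\<^sup>2) * (w\<^sup>2 + b\<^sup>2)) =
    (a * ((a + b) / S + (a - b) / D) - x * (1 / S + 1 / D) * (w + x)) / 2 / ((w + x)\<^sup>2 + a\<^sup>2) +
    (b * ((a + b) / S + (b - a) / D) + x * (1 / S + 1 / D) * w) / 2 / (w\<^sup>2 + b\<^sup>2)"
proof -
  define P R where "P = (w + x)\<^sup>2 + a\<^sup>2" and "R = w\<^sup>2 + b\<^sup>2"
  have pos: "0 < P" "0 < R" "0 < S" "0 < D"
    using assms by (auto simp: P_def R_def S_def D_def intro!: add_nonneg_pos)
  have "2 * (w * (w + x)) * S * D =
    (a * ((a + b) * D + (a - b) * S) - x * (D + S) * (w + x)) * R +
    (b * ((a + b) * D + (b - a) * S) + x * (D + S) * w) * P"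
    by (simp add: P_def R_def S_def D_def) algebra
  hence "(w * (w + x)) / (P * R) = 
    ((a * ((a + b) * D + (a - b) * S) - x * (D + S) * (w + x)) * R +
    (b * ((a + b) * D + (b - a) * S) + x * (D + S) * w) * P) / (2 * S * D * P * R)"
    using pos by (simp add: divide_simps)
  also have "\<dots> = ((a * ((a + b) * D + (a - b) * S) - x * (D + S) * (w + x)) / (S * D)) / 2 / P + 
    ((b * ((a + b) * D + (b - a) * S) + x * (D + S) * w) / (S * D)) / 2 / R"
    using pos by (simp add: divide_simps)
  also have "(a * ((a + b) * D + (a - b) * S) - x * (D + S) * (w + x)) / (S * D) =
      a * ((a + b) / S + (a - b) / D) - x * (1 / S + 1 / D) * (w + x)"
    using pos by (simp add: field_simps)
  also have "(b * ((a + b) * D + (b - a) * S) + x * (D + S) * w) / (S * D) =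
      b * ((a + b) / S + (b - a) / D) + x * (1 / S + 1 / D) * w"
    using pos by (simp add: field_simps)
  finally show ?thesis by (simp add: P_def R_def)
qed

text \<open>
  Writing \<open>1 / (w * (w\<^sup>2 + b\<^sup>2))\<close> as \<open>(1 / w - w / (w\<^sup>2 + b\<^sup>2)) / b\<^sup>2\<close> explains the shape of the
  value: integration against \<open>1 / w\<close> is a Hilbert transform, which turns a conjugate Poisson
  kernel into the Poisson kernel of the same height \<open>a\<close>, and integration against
  \<open>w / (w\<^sup>2 + b\<^sup>2)\<close> is in addition a convolution, which raises the height to \<open>a + b\<close>. The proof uses
  an explicit antiderivative instead.
\<close>

lemma integral_conj_poisson:
  fixes a b x :: real
  assumes ab: "0 < a" "0 < b" "a \<noteq> b"
  shows "integrable lborel_pos (\<lambda>w. conj_poisson a x w / (w * (w\<^sup>2 + b\<^sup>2)))" (is "integrable _ ?G")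
    and "(\<integral>w. \<bar>conj_poisson a x w / (w * (w\<^sup>2 + b\<^sup>2))\<bar> \<partial>lborel_pos) \<le> pi / (b * a\<^sup>2)"
    and "(\<integral>w. conj_poisson a x w / (w * (w\<^sup>2 + b\<^sup>2)) \<partial>lborel_pos) =
      pi / b\<^sup>2 * (a / (x\<^sup>2 + a\<^sup>2) - (a + b) / (x\<^sup>2 + (a + b)\<^sup>2))"
proof -
  have pos: "0 < (w + y)\<^sup>2 + a\<^sup>2" "0 < w\<^sup>2 + b\<^sup>2" "0 < (w - y)\<^sup>2 + a\<^sup>2" for w y :: real
    using ab by (auto intro!: add_nonneg_pos)
  note nz = pos[THEN less_imp_neq, symmetric]
  have bound: "\<bar>?G w\<bar> \<le> 2 / a\<^sup>2 * (1 / (w\<^sup>2 + b\<^sup>2))" if "0 < w" for w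
  proof -
    have "\<bar>?G w\<bar> = \<bar>conj_poisson a x w\<bar> / (w * (w\<^sup>2 + b\<^sup>2))"
      using that pos(2)[of w] by (simp add: abs_mult)
    also have "\<dots> \<le> 2 * w / a\<^sup>2 / (w * (w\<^sup>2 + b\<^sup>2))"
      using abs_conj_poisson_le[OF ab(1) that] that pos(2)[of w] by (intro divide_right_mono) auto
    also have "\<dots> = 2 / a\<^sup>2 * (1 / (w\<^sup>2 + b\<^sup>2))" using that by simp
    finally show ?thesis .
  qed
  have maj: "has_bochner_integral lborel_pos (\<lambda>w. 2 / a\<^sup>2 * (1 / (w\<^sup>2 + b\<^sup>2))) (2 / a\<^sup>2 * (pi / (2 * b)))"
    by (rule has_bochner_integral_mult_right) (simp add: has_bochner_integral_inverse_square_add ab)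
  have [measurable]: "?G \<in> borel_measurable lborel_pos"
    unfolding conj_poisson_def by measurable
  show int: "integrable lborel_pos ?G"
  proof (rule Bochner_Integration.integrable_bound)
    show "integrable lborel_pos (\<lambda>w. 2 / a\<^sup>2 * (1 / (w\<^sup>2 + b\<^sup>2)))"
      using maj by (simp only: has_bochner_integral_iff)
    show "AE w in lborel_pos. norm (?G w) \<le> norm (2 / a\<^sup>2 * (1 / (w\<^sup>2 + b\<^sup>2)))"
    proof (rule AE_I2)
      fix w assume "w \<in> space lborel_pos"
      hence "\<bar>?G w\<bar> \<le> 2 / a\<^sup>2 * (1 / (w\<^sup>2 + b\<^sup>2))" by (intro bound) simp
      thus "norm (?G w) \<le> norm (2 / a\<^sup>2 * (1 / (w\<^sup>2 + b\<^sup>2)))" unfolding real_norm_def by linarith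
    qed
  qed simp
  have "(\<integral>w. \<bar>?G w\<bar> \<partial>lborel_pos) \<le> (\<integral>w. 2 / a\<^sup>2 * (1 / (w\<^sup>2 + b\<^sup>2)) \<partial>lborel_pos)"
  proof (rule integral_mono_AE)
    show "integrable lborel_pos (\<lambda>w. \<bar>?G w\<bar>)" using int by (rule integrable_abs)
    show "AE w in lborel_pos. \<bar>?G w\<bar> \<le> 2 / a\<^sup>2 * (1 / (w\<^sup>2 + b\<^sup>2))"
      by (intro AE_I2 bound) simp
  qed (use maj in \<open>simp only: has_bochner_integral_iff\<close>)
  thus "(\<integral>w. \<bar>?G w\<bar> \<partial>lborel_pos) \<le> pi / (b * a\<^sup>2)"
    using maj by (simp add: has_bochner_integral_iff field_simps)

  define S D c where "S = x\<^sup>2 + (a + b)\<^sup>2" and "D = x\<^sup>2 + (a - b)\<^sup>2" and "c = x\<^sup>2 + a\<^sup>2"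
  \<comment> \<open>Partial fraction coefficients of the summand with the poles \<open>- x \<plusminus> \<i> a\<close>, where the one
    of \<open>1 / (w\<^sup>2 + b\<^sup>2)\<close> is \<open>\<delta> / 2\<close>. Under
    \<open>x \<mapsto> - x\<close> the coefficient \<open>\<kappa>\<close> is odd, while \<open>\<mu>\<close> and \<open>\<delta>\<close> are even; so the terms in
    \<open>1 / w\<close> and in \<open>w / (w\<^sup>2 + b\<^sup>2)\<close> cancel when the two summands are added.\<close>
  define \<kappa> where "\<kappa> = x / c - x * (1 / S + 1 / D) / 2"
  define \<mu> where "\<mu> = a\<^sup>2 / c - a * ((a + b) / S + (a - b) / D) / 2"
  define \<delta> where "\<delta> = b * ((a + b) / S + (b - a) / D)"
  define H where "H w = (\<mu> / a * (arctan ((w + x) / a) + arctan ((w - x) / a))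
      - \<kappa> / 2 * (ln ((w + x)\<^sup>2 + a\<^sup>2) - ln ((w - x)\<^sup>2 + a\<^sup>2)) - \<delta> / b * arctan (w / b)) / b\<^sup>2" for w
  have G_eq: "?G w = ((\<mu> - \<kappa> * (w + x)) / ((w + x)\<^sup>2 + a\<^sup>2) + (\<mu> + \<kappa> * (w - x)) / ((w - x)\<^sup>2 + a\<^sup>2)
      - \<delta> / (w\<^sup>2 + b\<^sup>2)) / b\<^sup>2" if w: "0 < w" for w
  proof -
    have half: "(w + y) / ((w + y)\<^sup>2 + a\<^sup>2) / (w * (w\<^sup>2 + b\<^sup>2)) =
        ((w + y) / (w * ((w + y)\<^sup>2 + a\<^sup>2)) - w * (w + y) / (((w + y)\<^sup>2 + a\<^sup>2) * (w\<^sup>2 + b\<^sup>2))) / b\<^sup>2" for y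
    proof -
      define P R where "P = (w + y)\<^sup>2 + a\<^sup>2" and "R = w\<^sup>2 + b\<^sup>2"
      have "0 < P" "0 < R" using pos by (auto simp: P_def R_def)
      moreover have "R = w * w + b * b" by (simp add: R_def power2_eq_square)
      ultimately have "(w + y) / P / (w * R) = ((w + y) / (w * P) - w * (w + y) / (P * R)) / b\<^sup>2"
        using w ab by (simp add: divide_simps power2_eq_square) (simp add: algebra_simps)
      thus ?thesis by (simp add: P_def R_def)
    qed
    have part: "(w + y) / (w * ((w + y)\<^sup>2 + a\<^sup>2)) - w * (w + y) / (((w + y)\<^sup>2 + a\<^sup>2) * (w\<^sup>2 + b\<^sup>2)) =
        y / (y\<^sup>2 + a\<^sup>2) / w +
        (a\<^sup>2 / (y\<^sup>2 + a\<^sup>2) - a * ((a + b) / (y\<^sup>2 + (a + b)\<^sup>2) + (a - b) / (y\<^sup>2 + (a - b)\<^sup>2)) / 2 -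
          (y / (y\<^sup>2 + a\<^sup>2) - y * (1 / (y\<^sup>2 + (a + b)\<^sup>2) + 1 / (y\<^sup>2 + (a - b)\<^sup>2)) / 2) * (w + y)) / ((w + y)\<^sup>2 + a\<^sup>2)
        - b * ((a + b) / (y\<^sup>2 + (a + b)\<^sup>2) + (b - a) / (y\<^sup>2 + (a - b)\<^sup>2)) / 2 / (w\<^sup>2 + b\<^sup>2)
        - y * (1 / (y\<^sup>2 + (a + b)\<^sup>2) + 1 / (y\<^sup>2 + (a - b)\<^sup>2)) / 2 * w / (w\<^sup>2 + b\<^sup>2)" for y
      unfolding partial_fractions_zero[OF ab(1) w] partial_fractions_square[OF ab]
      by (simp add: add_divide_distrib diff_divide_distrib ring_distribs)
    have plus: "(w + x) / ((w + x)\<^sup>2 + a\<^sup>2) / (w * (w\<^sup>2 + b\<^sup>2)) =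
        (x / c / w + (\<mu> - \<kappa> * (w + x)) / ((w + x)\<^sup>2 + a\<^sup>2) - \<delta> / 2 / (w\<^sup>2 + b\<^sup>2)
          - x * (1 / S + 1 / D) / 2 * w / (w\<^sup>2 + b\<^sup>2)) / b\<^sup>2"
      unfolding half[of x] part[of x] by (simp add: S_def D_def c_def \<kappa>_def \<mu>_def \<delta>_def)
    have minus: "(w - x) / ((w - x)\<^sup>2 + a\<^sup>2) / (w * (w\<^sup>2 + b\<^sup>2)) =
        (- (x / c / w) + (\<mu> + \<kappa> * (w - x)) / ((w - x)\<^sup>2 + a\<^sup>2) - \<delta> / 2 / (w\<^sup>2 + b\<^sup>2)
          + x * (1 / S + 1 / D) / 2 * w / (w\<^sup>2 + b\<^sup>2)) / b\<^sup>2"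
    proof -
      have \<kappa>': "(- x) / c - (- x) * (1 / S + 1 / D) / 2 = - \<kappa>" by (simp add: \<kappa>_def)
      show ?thesis
        using half[of "- x"] part[of "- x"]
        unfolding power2_minus S_def[symmetric] D_def[symmetric] c_def[symmetric]
          \<mu>_def[symmetric] \<delta>_def[symmetric] \<kappa>' 
        by simp
    qed
    have "?G w = (w + x) / ((w + x)\<^sup>2 + a\<^sup>2) / (w * (w\<^sup>2 + b\<^sup>2)) + (w - x) / ((w - x)\<^sup>2 + a\<^sup>2) / (w * (w\<^sup>2 + b\<^sup>2))"
      by (simp add: conj_poisson_def add_divide_distrib)
    also have "\<dots> = ((\<mu> - \<kappa> * (w + x)) / ((w + x)\<^sup>2 + a\<^sup>2) + (\<mu> + \<kappa> * (w - x)) / ((w - x)\<^sup>2 + a\<^sup>2)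
      - \<delta> / (w\<^sup>2 + b\<^sup>2)) / b\<^sup>2"
    proof -
      have "x / c / w + u - \<delta> / 2 / R - v + (- (x / c / w) + u' - \<delta> / 2 / R + v) = u + u' - \<delta> / R" for u u' v R :: real
        by (simp add: field_simps)
      thus ?thesis unfolding plus minus add_divide_distrib[symmetric] by (simp only:)
    qed
    finally show ?thesis .
  qed
  have lnp: "((\<lambda>w. ln ((w + y)\<^sup>2 + a\<^sup>2)) has_real_derivative 2 * (w + y) / ((w + y)\<^sup>2 + a\<^sup>2)) (at w)" for y w
    using pos(1)[of w y] by (auto intro!: derivative_eq_intros simp: divide_simps)
  have H: "(H has_real_derivative ?G w) (at w)" if w: "0 < w" for w
  proof -
    have "(H has_real_derivative (\<mu> / a * (a / ((w + x)\<^sup>2 + a\<^sup>2) + a / ((w - x)\<^sup>2 + a\<^sup>2))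
        - \<kappa> / 2 * (2 * (w + x) / ((w + x)\<^sup>2 + a\<^sup>2) - 2 * (w - x) / ((w - x)\<^sup>2 + a\<^sup>2))
        - \<delta> / b * (b / (w\<^sup>2 + b\<^sup>2))) / b\<^sup>2) (at w)"
      unfolding H_def
      using has_real_derivative_arctan_affine[OF ab(1), of x w] has_real_derivative_arctan_affine[OF ab(1), of "- x" w]
        has_real_derivative_arctan_affine[OF ab(2), of 0 w] lnp[of x] lnp[of "- x"]
      by (intro DERIV_cdivide DERIV_diff DERIV_add DERIV_cmult) auto
    also have "(\<mu> / a * (a / ((w + x)\<^sup>2 + a\<^sup>2) + a / ((w - x)\<^sup>2 + a\<^sup>2))
        - \<kappa> / 2 * (2 * (w + x) / ((w + x)\<^sup>2 + a\<^sup>2) - 2 * (w - x) / ((w - x)\<^sup>2 + a\<^sup>2))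
        - \<delta> / b * (b / (w\<^sup>2 + b\<^sup>2))) / b\<^sup>2 = ?G w"
      unfolding G_eq[OF w] using ab
      by (simp add: add_divide_distrib diff_divide_distrib ring_distribs)
    finally show ?thesis .
  qed
  have cont: "isCont ?G w" if "0 < w" for w
    unfolding conj_poisson_def using that nz by (auto intro!: continuous_intros)
  have H0: "(H \<longlongrightarrow> 0) (at_right 0)"
  proof -
    have "isCont H 0"
      unfolding H_def using nz[of 0] ab by (auto intro!: continuous_intros)
    hence "(H \<longlongrightarrow> H 0) (at_right 0)"
      by (simp add: continuous_at_imp_continuous_at_within isCont_def filterlim_at_split)
    moreover have "H 0 = 0"
      using arctan_minus[of "x / a"] by (simp add: H_def)
    ultimately show ?thesis by simp
  qed
  have Hinf: "(H \<longlongrightarrow> (\<mu> / a * (pi / 2 + pi / 2) - \<kappa> / 2 * 0 - \<delta> / b * (pi / 2)) / b\<^sup>2) at_top"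
    unfolding H_def
  proof (intro tendsto_intros)
    show "((\<lambda>w. arctan ((w + x) / a)) \<longlongrightarrow> pi / 2) at_top" using ab by real_asymp
    show "((\<lambda>w. arctan ((w - x) / a)) \<longlongrightarrow> pi / 2) at_top" using ab by real_asymp
    show "((\<lambda>w. arctan (w / b)) \<longlongrightarrow> pi / 2) at_top" using ab by real_asymp
    show "((\<lambda>w. ln ((w + x)\<^sup>2 + a\<^sup>2) - ln ((w - x)\<^sup>2 + a\<^sup>2)) \<longlongrightarrow> 0) at_top" using ab by real_asymp
  qed (use ab in auto)
  have "integral\<^sup>L lborel_pos ?G = (\<mu> / a * (pi / 2 + pi / 2) - \<kappa> / 2 * 0 - \<delta> / b * (pi / 2)) / b\<^sup>2 - 0"
    by (rule integral_lborel_pos_FTC[OF H cont int H0 Hinf])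
  also have "\<dots> = pi / b\<^sup>2 * (\<mu> / a - \<delta> / b / 2)" by (simp add: algebra_simps diff_divide_distrib)
  also have "\<mu> / a - \<delta> / b / 2 = a / c - (a + b) / S"
    using ab by (simp add: \<mu>_def \<delta>_def power2_eq_square diff_divide_distrib add_divide_distrib)
  finally show "integral\<^sup>L lborel_pos ?G =
      pi / b\<^sup>2 * (a / (x\<^sup>2 + a\<^sup>2) - (a + b) / (x\<^sup>2 + (a + b)\<^sup>2))"
    by (simp add: c_def S_def)
qed

section \<open>An integral representation of the density\<close>

text \<open>
  The jump of \<open>phi0\<close> across the cut \<open>(-\<infinity>, 0)\<close>, divided by \<open>2 pi \<i>\<close>, at the two points
  \<open>- exp w\<close> and \<open>- exp (- w)\<close>, in the logarithmic coordinate \<open>w\<close>: up to opposite signs it has the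
  same size at both points.
\<close>

definition weight :: "real \<Rightarrow> real" where
  "weight w = 2 / (w * (w\<^sup>2 + (2 * pi)\<^sup>2))"

text \<open>
  The partial fraction expansion of the hyperbolic tangent is integrated term by term. The heights
  \<open>a k = (2 k + 1) pi\<close> have spacing \<open>2 pi\<close>, which is also the number \<open>b\<close> in the weight; so the
  height \<open>a k + b\<close> of the second Poisson kernel is \<open>a (k + 1)\<close>, and the sum telescopes to its
  first term, the Poisson kernel of height \<open>pi\<close>.
\<close>

lemma has_bochner_integral_weight_sinh:
  fixes x :: real
  shows "has_bochner_integral lborel_pos (\<lambda>w. weight w * (sinh w / (cosh w + cosh x))) (1 / (pi\<^sup>2 + x\<^sup>2))"
proof -
  define a where "a k = (2 * real k + 1) * pi" for k
  have a_pos: "0 < a k" for k by (simp add: a_def)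
  have a_Suc: "a (Suc k) = a k + 2 * pi" for k by (simp add: a_def algebra_simps)
  \<comment> \<open>An odd multiple of \<open>pi\<close> is never \<open>2 pi\<close>, so the partial fractions have no double poles.\<close>
  have a_ne: "a k \<noteq> 2 * pi" for k
  proof
    assume "a k = 2 * pi"
    hence "real (2 * k + 1) = real 2" by (simp add: a_def)
    hence "2 * k + 1 = 2" by (simp only: of_nat_eq_iff)
    thus False by presburger
  qed
  define G where "G k w = conj_poisson (a k) x w / (w * (w\<^sup>2 + (2 * pi)\<^sup>2))" for k w
  have G_sums: "(\<lambda>k. 4 * G k w) sums (weight w * (sinh w / (cosh w + cosh x)))" for w
  proof -
    have "(\<lambda>k. weight w / 2 * (4 * (w + x) / ((w + x)\<^sup>2 + (a k)\<^sup>2) + 4 * (w - x) / ((w - x)\<^sup>2 + (a k)\<^sup>2))) sums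
        (weight w / 2 * (tanh ((w + x) / 2) + tanh ((w - x) / 2)))"
      unfolding a_def by (intro sums_mult sums_add sums_tanh_half)
    also have "(\<lambda>k. weight w / 2 * (4 * (w + x) / ((w + x)\<^sup>2 + (a k)\<^sup>2) + 4 * (w - x) / ((w - x)\<^sup>2 + (a k)\<^sup>2)))
        = (\<lambda>k. 4 * G k w)"
    proof
      fix k
      have "4 * (w + x) / ((w + x)\<^sup>2 + (a k)\<^sup>2) + 4 * (w - x) / ((w - x)\<^sup>2 + (a k)\<^sup>2) = 4 * conj_poisson (a k) x w"
        by (simp add: conj_poisson_def)
      thus "weight w / 2 * (4 * (w + x) / ((w + x)\<^sup>2 + (a k)\<^sup>2) + 4 * (w - x) / ((w - x)\<^sup>2 + (a k)\<^sup>2)) = 4 * G k w"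
        by (simp only:) (simp add: weight_def G_def)
    qed
    finally show ?thesis by (simp add: sinh_div_cosh_add_cosh)
  qed
  have inverse_squares: "summable (\<lambda>k. 1 / (a k)\<^sup>2)"
  proof (rule summable_comparison_test'[where g = "\<lambda>k. 1 / real (Suc k) ^ 2" and N = 0])
    show "summable (\<lambda>k. 1 / real (Suc k) ^ 2)"
      using inverse_power_summable[of 2, where 'a = real]
      by (subst summable_Suc_iff) (simp add: field_simps)
    fix k :: nat
    have "real (Suc k) * 1 \<le> (2 * real k + 1) * pi"
      using pi_ge_two by (intro mult_mono) auto
    hence "(real (Suc k))\<^sup>2 \<le> (a k)\<^sup>2" by (intro power_mono) (auto simp: a_def)
    thus "norm (1 / (a k)\<^sup>2) \<le> 1 / real (Suc k) ^ 2"
      using a_pos[of k] by (simp add: frac_le)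
  qed
  have int: "integrable lborel_pos (\<lambda>w. 4 * G k w)" for k
    unfolding G_def by (intro integrable_mult_right integral_conj_poisson(1)) (use a_pos a_ne in auto)
  have AE_sum: "AE w in lborel_pos. summable (\<lambda>k. norm (4 * G k w))"
  proof (rule AE_I2)
    fix w assume "w \<in> space lborel_pos"
    hence w: "0 < w" by simp
    show "summable (\<lambda>k. norm (4 * G k w))"
    proof (rule summable_comparison_test'[where N = 0])
      show "summable (\<lambda>k. 4 * (weight w * w) * (1 / (a k)\<^sup>2))"
        by (rule summable_mult[OF inverse_squares])
      fix k
      have "\<bar>G k w\<bar> = \<bar>conj_poisson (a k) x w\<bar> * (weight w / 2)"
        using w by (simp add: G_def weight_def abs_mult)
      also have "\<dots> \<le> 2 * w / (a k)\<^sup>2 * (weight w / 2)"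
        using w by (intro mult_right_mono abs_conj_poisson_le[OF a_pos w]) (simp add: weight_def)
      also have "\<dots> = weight w * w * (1 / (a k)\<^sup>2)" by simp
      finally have "4 * \<bar>G k w\<bar> \<le> 4 * (weight w * w * (1 / (a k)\<^sup>2))" by (rule mult_left_mono) simp
      thus "norm (norm (4 * G k w)) \<le> 4 * (weight w * w) * (1 / (a k)\<^sup>2)"
        by (simp add: abs_mult mult.assoc)
    qed
  qed
  have sum_int: "summable (\<lambda>k. \<integral>w. norm (4 * G k w) \<partial>lborel_pos)"
  proof (rule summable_comparison_test'[where N = 0])
    show "summable (\<lambda>k. 2 * (1 / (a k)\<^sup>2))"
      by (rule summable_mult[OF inverse_squares])
    fix k
    have "(\<integral>w. norm (4 * G k w) \<partial>lborel_pos) = 4 * (\<integral>w. \<bar>G k w\<bar> \<partial>lborel_pos)"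
      by (simp add: abs_mult)
    also have "\<dots> \<le> 4 * (pi / (2 * pi * (a k)\<^sup>2))"
      using integral_conj_poisson(2)[OF a_pos[of k] _ a_ne[of k], of x] by (intro mult_left_mono) (auto simp: G_def)
    finally show "norm (\<integral>w. norm (4 * G k w) \<partial>lborel_pos) \<le> 2 * (1 / (a k)\<^sup>2)"
      by (simp add: abs_of_nonneg Bochner_Integration.integral_nonneg)
  qed
  have suminf: "(\<Sum>k. 4 * G k w) = weight w * (sinh w / (cosh w + cosh x))" for w
    using G_sums by (simp add: sums_iff)
  have "integrable lborel_pos (\<lambda>w. weight w * (sinh w / (cosh w + cosh x)))"
    using integrable_suminf[OF int AE_sum sum_int] by (simp only: suminf)
  moreover have "(\<lambda>k. \<integral>w. 4 * G k w \<partial>lborel_pos) sums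
      (\<integral>w. weight w * (sinh w / (cosh w + cosh x)) \<partial>lborel_pos)"
    using sums_integral[OF int AE_sum sum_int] by (simp only: suminf)
  moreover have "(\<lambda>k. \<integral>w. 4 * G k w \<partial>lborel_pos) sums (1 / (pi\<^sup>2 + x\<^sup>2))"
  proof -
    have "(\<lambda>k. a k / (x\<^sup>2 + (a k)\<^sup>2)) \<longlonglongrightarrow> 0"
      unfolding a_def by real_asymp
    from telescope_sums'[OF this]
    have "(\<lambda>k. 1 / pi * (a k / (x\<^sup>2 + (a k)\<^sup>2) - a (Suc k) / (x\<^sup>2 + (a (Suc k))\<^sup>2))) sums
        (1 / pi * (a 0 / (x\<^sup>2 + (a 0)\<^sup>2) - 0))"
      by (rule sums_mult)
    also have "(\<lambda>k. 1 / pi * (a k / (x\<^sup>2 + (a k)\<^sup>2) - a (Suc k) / (x\<^sup>2 + (a (Suc k))\<^sup>2))) =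
        (\<lambda>k. \<integral>w. 4 * G k w \<partial>lborel_pos)"
    proof
      fix k
      have "(\<integral>w. 4 * G k w \<partial>lborel_pos) = 4 * (\<integral>w. G k w \<partial>lborel_pos)" by simp
      also have "\<dots> = 4 * (pi / (2 * pi)\<^sup>2 * (a k / (x\<^sup>2 + (a k)\<^sup>2) - a (Suc k) / (x\<^sup>2 + (a (Suc k))\<^sup>2)))"
        unfolding G_def a_Suc by (subst integral_conj_poisson(3)) (use a_pos a_ne in auto)
      also have "\<dots> = 1 / pi * (a k / (x\<^sup>2 + (a k)\<^sup>2) - a (Suc k) / (x\<^sup>2 + (a (Suc k))\<^sup>2))"
      proof -
        have "4 * (pi / (2 * pi)\<^sup>2 * u) = 1 / pi * u" for u :: real by (simp add: power2_eq_square)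
        thus ?thesis .
      qed
      finally show "1 / pi * (a k / (x\<^sup>2 + (a k)\<^sup>2) - a (Suc k) / (x\<^sup>2 + (a (Suc k))\<^sup>2)) =
        (\<integral>w. 4 * G k w \<partial>lborel_pos)" ..
    qed
    finally show ?thesis by (simp add: a_def add.commute)
  qed
  ultimately show ?thesis
    unfolding has_bochner_integral_iff by (metis sums_unique2)
qed

text \<open>
  The Cauchy integral of \<open>phi0\<close> along the cut, with the points \<open>- exp w\<close> and \<open>- exp (- w)\<close> paired. The
  pairing makes the integrand nonnegative and removes the principal value at \<open>w = 0\<close>. In the
  coordinate \<open>x = ln t\<close> the paired kernel is \<open>sinh w / (cosh w + cosh x)\<close> up to the factor
  \<open>1 / t\<close>.
\<close>

lemma has_bochner_integral_phi0_cut: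
  assumes t: "0 < t"
  shows "has_bochner_integral lborel_pos (\<lambda>w. weight w * (1 / (t + exp (- w)) - 1 / (t + exp w))) (phi0 t)"
proof -
  define x where "x = ln t"
  have t_eq: "t = exp x" using t by (simp add: x_def)
  have "has_bochner_integral lborel_pos (\<lambda>w. 1 / t * (weight w * (sinh w / (cosh w + cosh x)))) (1 / t * (1 / (pi\<^sup>2 + x\<^sup>2)))"
    by (intro has_bochner_integral_mult_right has_bochner_integral_weight_sinh)
  moreover have "1 / t * (weight w * (sinh w / (cosh w + cosh x))) = weight w * (1 / (t + exp (- w)) - 1 / (t + exp w))" for w
  proof -
    have ne: "t + exp (- w) > 0" "t + exp w > 0" using t by (auto intro: add_pos_pos)
    have "(t + exp (- w)) * (t + exp w) = 2 * (t * (cosh w + cosh x))"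
      using exp_minus_inverse[of w]
      by (simp add: cosh_def t_eq exp_minus field_simps)
    moreover have "1 / (t + exp (- w)) - 1 / (t + exp w) = 2 * sinh w / ((t + exp (- w)) * (t + exp w))"
    proof -
      have "2 * sinh w = (t + exp w) - (t + exp (- w))" by (simp add: sinh_def)
      thus ?thesis using ne by (simp only:) (simp add: diff_frac_eq)
    qed
    ultimately have "1 / (t + exp (- w)) - 1 / (t + exp w) = 1 / t * (sinh w / (cosh w + cosh x))"
      by (simp del: distrib_left_numeral)
    thus ?thesis by simp
  qed
  ultimately show ?thesis by (simp add: phi0_def x_def)
qed

text \<open>
  The inner difference is nonnegative because \<open>exp (- w) < exp w\<close>; here lies the positivity on
  which complete monotonicity of \<open>phi0\<close> rests.
\<close>

definition phi0_inverse_laplace :: "real \<Rightarrow> ennreal" where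
  "phi0_inverse_laplace s = (\<integral>\<^sup>+w. ennreal (weight w * (exp (- (exp (- w) * s)) - exp (- (exp w * s)))) \<partial>lborel_pos)"

lemma laplace_transform_phi0: "laplace_transform_of phi0_inverse_laplace phi0"
  unfolding laplace_transform_of_def
proof (intro conjI allI impI)
  have [measurable]: "weight \<in> borel_measurable borel"
    unfolding weight_def[abs_def] by measurable
  show "phi0_inverse_laplace \<in> borel_measurable lborel_pos"
    unfolding phi0_inverse_laplace_def by measurable
  fix t :: real assume t: "0 < t"
  show "0 \<le> phi0 t" using t by (simp add: phi0_def)
  have weight_nonneg: "0 \<le> weight w" if "0 < w" for w using that by (simp add: weight_def)
  have inner: "(\<integral>\<^sup>+s. ennreal (weight w * (exp (- (exp (- w) * s)) - exp (- (exp w * s)))) * ennreal (exp (- (t * s))) \<partial>lborel_pos)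
      = ennreal (weight w * (1 / (t + exp (- w)) - 1 / (t + exp w)))" if w: "0 < w" for w
  proof -
    have "has_bochner_integral lborel_pos
        (\<lambda>s. weight w * (exp (- ((t + exp (- w)) * s)) - exp (- ((t + exp w) * s))))
        (weight w * (1 / (t + exp (- w)) - 1 / (t + exp w)))"
      using t by (intro has_bochner_integral_mult_right has_bochner_integral_diff has_bochner_integral_exp_pos)
        (auto intro: add_pos_pos)
    moreover have nonneg: "0 \<le> weight w * (exp (- ((t + exp (- w)) * s)) - exp (- ((t + exp w) * s)))" if "0 < s" for s
      using w that by (intro mult_nonneg_nonneg weight_nonneg) (auto intro!: mult_right_mono)
    ultimately have "(\<integral>\<^sup>+s. ennreal (weight w * (exp (- ((t + exp (- w)) * s)) - exp (- ((t + exp w) * s)))) \<partial>lborel_pos)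
       = ennreal (weight w * (1 / (t + exp (- w)) - 1 / (t + exp w)))"
      by (subst nn_integral_eq_integral) (auto simp: has_bochner_integral_iff intro!: AE_I2)
    moreover have "ennreal (weight w * (exp (- (exp (- w) * s)) - exp (- (exp w * s)))) * ennreal (exp (- (t * s))) =
        ennreal (weight w * (exp (- ((t + exp (- w)) * s)) - exp (- ((t + exp w) * s))))" for s
      by (simp add: ennreal_mult''[symmetric] ring_distribs exp_add[symmetric] add.commute mult.assoc exp_diff exp_minus)
        (simp add: field_simps exp_add)
    ultimately show ?thesis by simp
  qed
  have "(\<integral>\<^sup>+s. phi0_inverse_laplace s * ennreal (exp (- (t * s))) \<partial>lborel_pos) =
     (\<integral>\<^sup>+s. (\<integral>\<^sup>+w. ennreal (weight w * (exp (- (exp (- w) * s)) - exp (- (exp w * s)))) * ennreal (exp (- (t * s))) \<partial>lborel_pos) \<partial>lborel_pos)"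
    unfolding phi0_inverse_laplace_def by (subst nn_integral_multc[symmetric]) auto
  also have "\<dots> = (\<integral>\<^sup>+w. (\<integral>\<^sup>+s. ennreal (weight w * (exp (- (exp (- w) * s)) - exp (- (exp w * s)))) * ennreal (exp (- (t * s))) \<partial>lborel_pos) \<partial>lborel_pos)"
    by (rule lborel_pos_pair.Fubini') measurable
  also have "\<dots> = (\<integral>\<^sup>+w. ennreal (weight w * (1 / (t + exp (- w)) - 1 / (t + exp w))) \<partial>lborel_pos)"
    by (intro nn_integral_cong inner) simp
  also have "\<dots> = ennreal (phi0 t)"
  proof -
    have "0 \<le> weight w * (1 / (t + exp (- w)) - 1 / (t + exp w))" if "0 < w" for w
      using that t by (intro mult_nonneg_nonneg weight_nonneg)
        (auto intro!: divide_left_mono add_pos_pos mult_pos_pos)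
    thus ?thesis
      using has_bochner_integral_phi0_cut[OF t]
      by (subst nn_integral_eq_integral) (auto simp: has_bochner_integral_iff intro!: AE_I2)
  qed
  finally show "(\<integral>\<^sup>+s. phi0_inverse_laplace s * ennreal (exp (- (t * s))) \<partial>lborel_pos) = ennreal (phi0 t)" .
qed

section \<open>The functions \<open>I_R\<close> and \<open>P_R\<close>\<close>

text \<open>
  The antiderivative \<open>arctan (ln t / pi) / pi\<close> shows that \<open>phi0\<close> is integrable in spite of the factor
  \<open>1 / t\<close>. Up to a constant factor, \<open>phi0\<close> is the majorant in all convergence arguments below.
\<close>

lemma has_bochner_integral_phi0: "has_bochner_integral lborel_pos phi0 1"
proof -
  have pos: "0 < pi\<^sup>2 + (ln t)\<^sup>2" for t by (auto intro!: add_pos_nonneg)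
  have "has_bochner_integral lborel_pos phi0 (1 / 2 - (- 1 / 2))"
  proof (rule has_bochner_integral_lborel_pos_FTC)
    fix t :: real assume t: "0 < t"
    have "((\<lambda>t. arctan ((ln t + 0) / pi)) has_real_derivative pi / ((ln t + 0)\<^sup>2 + pi\<^sup>2) * (1 / t)) (at t)"
      using t by (intro DERIV_chain2[OF has_real_derivative_arctan_affine]) (auto intro!: derivative_eq_intros simp: divide_inverse)
    from DERIV_cdivide[OF this, of pi]
    show "((\<lambda>t. arctan (ln t / pi) / pi) has_real_derivative phi0 t) (at t)"
      by (simp add: phi0_def add.commute mult.commute)
    show "isCont phi0 t"
      unfolding phi0_def[abs_def] using t pos[of t] by (intro continuous_intros) auto
    show "0 \<le> phi0 t" using t by (simp add: phi0_def)
  next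
    have "((\<lambda>t. arctan (ln t / pi)) \<longlongrightarrow> - (pi / 2)) (at_right 0)"
    proof (rule filterlim_compose[OF tendsto_arctan_at_bot])
      show "LIM t at_right 0. ln t / pi :> at_bot" by real_asymp
    qed
    from tendsto_divide[OF this tendsto_const[of pi]]
    show "((\<lambda>t. arctan (ln t / pi) / pi) \<longlongrightarrow> - 1 / 2) (at_right 0)" by simp
    have "((\<lambda>t. arctan (ln t / pi)) \<longlongrightarrow> pi / 2) at_top"
    proof (rule filterlim_compose[OF tendsto_arctan_at_top])
      show "LIM t at_top. ln t / pi :> at_top" by real_asymp
    qed
    from tendsto_divide[OF this tendsto_const[of pi]]
    show "((\<lambda>t. arctan (ln t / pi) / pi) \<longlongrightarrow> 1 / 2) at_top" by simp
  qed
  thus ?thesis by simp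
qed

lemma integrable_phi0: "integrable lborel_pos phi0"
  using has_bochner_integral_phi0 by (simp add: has_bochner_integral_iff)

lemma phi0_measurable [measurable]: "phi0 \<in> borel_measurable borel"
  unfolding phi0_def[abs_def] by measurable

lemma phi0_nonneg: "0 < t \<Longrightarrow> 0 \<le> phi0 t"
  by (simp add: phi0_def)

lemma integrable_exp_phi0:
  assumes "0 < x"
  shows "integrable lborel_pos (\<lambda>t. exp (- (x * t)) * phi0 t)"
proof (rule Bochner_Integration.integrable_bound[OF integrable_phi0])
  show "AE t in lborel_pos. norm (exp (- (x * t)) * phi0 t) \<le> norm (phi0 t)"
    using assms by (intro AE_I2) (simp add: abs_mult mult_left_le_one_le)
qed simp

lemma one_minus_exp_le: "1 - exp (- y) \<le> (y :: real)"
  using exp_ge_add_one_self[of "- y"] by simp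

lemma integrable_one_minus_exp_phi0:
  assumes "0 < x"
  shows "integrable lborel_pos (\<lambda>t. (1 - exp (- (x * t))) * (phi0 t / t))"
proof (rule Bochner_Integration.integrable_bound[OF integrable_mult_right[OF integrable_phi0]])
  show "AE t in lborel_pos. norm ((1 - exp (- (x * t))) * (phi0 t / t)) \<le> norm (x * phi0 t)"
  proof (rule AE_I2)
    fix t assume "t \<in> space lborel_pos"
    hence t: "0 < t" by simp
    have "(1 - exp (- (x * t))) * (phi0 t / t) \<le> (x * t) * (phi0 t / t)"
      using t phi0_nonneg by (intro mult_right_mono one_minus_exp_le) auto
    moreover have "0 \<le> (1 - exp (- (x * t))) * (phi0 t / t)"
      using t assms phi0_nonneg by (intro mult_nonneg_nonneg) auto
    ultimately show "norm ((1 - exp (- (x * t))) * (phi0 t / t)) \<le> norm (x * phi0 t)"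
      using t by simp
  qed
qed simp

lemma I_R_eq: "I_R x = (\<integral>t. exp (- (x * t)) * phi0 t \<partial>lborel_pos)"
  by (simp add: I_R_def set_integral_eq_lborel_pos phi0_def)

lemma P_R_eq: "P_R c x = c + (\<integral>t. (1 - exp (- (x * t))) * (phi0 t / t) \<partial>lborel_pos)"
  by (simp add: P_R_def set_integral_eq_lborel_pos phi0_def power2_eq_square mult.assoc mult.commute mult.left_commute)

lemma laplace_transform_I_R: "laplace_transform_of (\<lambda>t. ennreal (phi0 t)) I_R"
  unfolding laplace_transform_of_def
proof (intro conjI allI impI)
  fix x :: real assume x: "0 < x"
  have nonneg: "AE t in lborel_pos. 0 \<le> exp (- (x * t)) * phi0 t"
    by (intro AE_I2) (simp add: phi0_nonneg)
  show "0 \<le> I_R x" unfolding I_R_eq by (rule integral_nonneg_AE[OF nonneg])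
  have "(\<integral>\<^sup>+t. ennreal (phi0 t) * ennreal (exp (- (x * t))) \<partial>lborel_pos) =
      (\<integral>\<^sup>+t. ennreal (exp (- (x * t)) * phi0 t) \<partial>lborel_pos)"
    by (simp add: ennreal_mult''[symmetric] mult.commute)
  also have "\<dots> = ennreal (I_R x)"
    unfolding I_R_eq by (rule nn_integral_eq_integral[OF integrable_exp_phi0[OF x] nonneg])
  finally show "(\<integral>\<^sup>+t. ennreal (phi0 t) * ennreal (exp (- (x * t))) \<partial>lborel_pos) = ennreal (I_R x)" .
qed simp

lemma P_R_has_derivative:
  assumes x: "0 < x"
  shows "(P_R c has_real_derivative I_R x) (at x)"
proof -
  have "((\<lambda>y. \<integral>t. (1 - exp (- (y * t))) * (phi0 t / t) \<partial>lborel_pos) has_real_derivative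
      (\<integral>t. exp (- (x * t)) * phi0 t \<partial>lborel_pos)) (at x)"
  proof (rule has_real_derivative_integral)
    show "((\<lambda>y. (1 - exp (- (y * t))) * (phi0 t / t)) has_real_derivative exp (- (y * t)) * phi0 t) (at y)"
      if "t \<in> space lborel_pos" for y t
      using that by (auto intro!: derivative_eq_intros)
    fix y assume "\<bar>y - x\<bar> < x"
    hence y: "0 < y" by (auto simp: abs_if split: if_splits)
    show "integrable lborel_pos (\<lambda>t. (1 - exp (- (y * t))) * (phi0 t / t))"
      by (rule integrable_one_minus_exp_phi0[OF y])
    show "\<bar>exp (- (y * t)) * phi0 t\<bar> \<le> phi0 t" if "t \<in> space lborel_pos" for t
      using that y phi0_nonneg[of t] by (simp add: abs_mult mult_left_le_one_le)
  qed (use x integrable_phi0 in auto)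
  hence "((\<lambda>y. c + (\<integral>t. (1 - exp (- (y * t))) * (phi0 t / t) \<partial>lborel_pos)) has_real_derivative
      0 + (\<integral>t. exp (- (x * t)) * phi0 t \<partial>lborel_pos)) (at x)"
    by (intro DERIV_add DERIV_const)
  thus ?thesis unfolding I_R_eq P_R_eq[abs_def] by simp
qed

lemma bernstein_function_antiderivative:
  fixes g h :: "real \<Rightarrow> real"
  assumes nonneg: "\<And>x. 0 < x \<Longrightarrow> 0 \<le> g x"
    and deriv: "\<And>x. 0 < x \<Longrightarrow> (g has_real_derivative h x) (at x)"
    and h: "completely_monotone h"
  shows "bernstein_function g"
proof -
  have deriv_g: "deriv g x = h x" if "0 < x" for x
    using deriv[OF that] by (rule DERIV_imp_deriv)
  have cm: "completely_monotone (deriv g)"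
    by (rule completely_monotone_cong[OF deriv_g h])
  have "(deriv ^^ n) g differentiable (at x)" if "0 < x" for n x
  proof (cases n)
    case 0
    thus ?thesis using deriv[OF that] by (auto simp: real_differentiable_def)
  next
    case (Suc m)
    thus ?thesis
      using cm that by (simp add: completely_monotone_def smooth_on_pos_def funpow_Suc_right del: funpow.simps)
  qed
  thus ?thesis
    using nonneg cm by (simp add: bernstein_function_def smooth_on_pos_def)
qed

text \<open>
  The Levy density is \<open>phi0 t / t\<close>, which is completely monotone as a Laplace transform divided by
  its variable.
\<close>

lemma complete_bernstein_function_P_R:
  assumes c: "0 \<le> c"
  shows "complete_bernstein_function (P_R c)"
proof -
  define \<nu> where "\<nu> = density lborel_pos (\<lambda>t. ennreal (phi0 t / t))"
  have nn: "AE t in lborel_pos. 0 \<le> phi0 t / t"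
    by (intro AE_I2) (simp add: phi0_nonneg)
  have "0 \<le> P_R c x" if "0 < x" for x
    unfolding P_R_eq using c that phi0_nonneg
    by (intro add_nonneg_nonneg integral_nonneg_AE AE_I2 mult_nonneg_nonneg) auto
  hence bernstein: "bernstein_function (P_R c)"
    using P_R_has_derivative laplace_transform_imp_completely_monotone[OF laplace_transform_I_R]
    by (rule bernstein_function_antiderivative)
  have "integrable lborel_pos (\<lambda>t. (phi0 t / t) *\<^sub>R min 1 t)"
  proof (rule Bochner_Integration.integrable_bound[OF integrable_phi0])
    show "AE t in lborel_pos. norm ((phi0 t / t) *\<^sub>R min 1 t) \<le> norm (phi0 t)"
    proof (rule AE_I2)
      fix t assume "t \<in> space lborel_pos"
      hence t: "0 < t" by simp
      have "(phi0 t / t) * min 1 t \<le> (phi0 t / t) * t"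
        using t phi0_nonneg[OF t] by (intro mult_left_mono) auto
      thus "norm ((phi0 t / t) *\<^sub>R min 1 t) \<le> norm (phi0 t)"
        using t phi0_nonneg[OF t] by (simp add: abs_mult)
    qed
  qed simp
  hence min: "integrable \<nu> (\<lambda>t. min 1 t)"
    unfolding \<nu>_def using nn by (subst integrable_density) auto
  have "P_R c x = c + 0 * x + (\<integral>t. (1 - exp (- (x * t))) \<partial>\<nu>)" for x
    unfolding \<nu>_def P_R_eq using nn by (subst integral_density) (auto simp: mult.commute)
  hence "levy_triplet (P_R c) c 0 \<nu>"
    using c min by (simp add: levy_triplet_def measure_on_pos_def \<nu>_def sets_lborel_pos)
  moreover have "completely_monotone (\<lambda>t. phi0 t / t)"
    by (rule laplace_transform_imp_completely_monotone[OF laplace_transform_divide_id[OF laplace_transform_phi0]])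
  ultimately show ?thesis
    unfolding complete_bernstein_function_def using bernstein \<nu>_def by blast
qed

theorem theorem6p1:
  shows "completely_monotone phi0 \<and>
    (\<forall>x>0. set_integrable lborel {0<..} (\<lambda>t. exp (- (x * t)) / (t * (pi\<^sup>2 + (ln t)\<^sup>2)))) \<and>
    stieltjes_function I_R \<and>
    (\<forall>x>0. set_integrable lborel {0<..} (\<lambda>t. (1 - exp (- (x * t))) / (t\<^sup>2 * (pi\<^sup>2 + (ln t)\<^sup>2)))) \<and>
    (\<forall>c\<ge>0. (\<forall>x>0. (P_R c has_real_derivative I_R x) (at x)) \<and>
       complete_bernstein_function (P_R c))"
proof (intro conjI allI impI)
  show "completely_monotone phi0"
    by (rule laplace_transform_imp_completely_monotone[OF laplace_transform_phi0])
  show "stieltjes_function I_R"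
    by (rule laplace_transform_twice_imp_stieltjes[OF laplace_transform_phi0 laplace_transform_I_R])
  show "set_integrable lborel {0<..} (\<lambda>t. exp (- (x * t)) / (t * (pi\<^sup>2 + (ln t)\<^sup>2)))" if "0 < x" for x
    using integrable_exp_phi0[OF that] by (simp add: set_integrable_iff_lborel_pos phi0_def)
  show "set_integrable lborel {0<..} (\<lambda>t. (1 - exp (- (x * t))) / (t\<^sup>2 * (pi\<^sup>2 + (ln t)\<^sup>2)))" if "0 < x" for x
    using integrable_one_minus_exp_phi0[OF that]
    by (simp add: set_integrable_iff_lborel_pos phi0_def power2_eq_square mult.assoc mult.commute mult.left_commute)
qed (use P_R_has_derivative complete_bernstein_function_P_R in auto)

end
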